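(* For every integer $n\geq 4$, the pancake graph $P_n$ is super-connected; that is, every minimum vertex cut of $P_n$ is the neighbor set of a single vertex of $P_n$.
   Context: For $n\ge 2$ and $2\leq j\leq n$, let $r_{1j}\in S_n$ be the prefix reversal, i.e. the permutation of $\{1,\dots,n\}$ with $r_{1j}(k)=j+1-k$ for $1\leq k\leq j$ and $r_{1j}(k)=k$ for $j<k\leq n$. Let $PR_n=\{r_{1j}: 2\leq j\leq n\}$. The pancake graph $P_n$ is the Cayley graph $\mathrm{Cay}(S_n,PR_n)$: the simple undirected graph with vertex set the symmetric group $S_n$ and edges $\{g,gs\}$ for $g\in S_n$, $s\in PR_n$, where products of permutations are composed as $(gs)(k)=g(s(k))$. A graph $X$ is super-connected if each minimum vertex cut (a vertex set of minimum cardinality whose removal disconnects $X$) is the set of neighbors of a single vertex of $X$. *)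

theory Defs
  imports "HOL-Algebra.Sym_Groups" "Graph_Theory.Pair_Digraph" "Graph_Theory.Digraph_Component"
begin

text \<open>
  An undirected graph is represented as a symmetric digraph: the edge \<open>{x, y}\<close> is the pair of arcs
  \<open>(x, y)\<close> and \<open>(y, x)\<close>. The definition keeps only \<open>x \<noteq> y\<close> and does not presuppose that \<open>S\<close> is closed
  under inverses, so it always yields a simple undirected graph (lemma \<open>pair_graph_cayley_graph\<close>).
\<close>

definition cayley_graph :: "('a, 'm) monoid_scheme \<Rightarrow> 'a set \<Rightarrow> 'a pair_pre_digraph" where
  "cayley_graph G S = \<lparr> pverts = carrier G,
     parcs = {(x, y). x \<in> carrier G \<and> y \<in> carrier G \<and> x \<noteq> y \<and>
       (\<exists>s\<in>S. y = x \<otimes>\<^bsub>G\<^esub> s \<or> x = y \<otimes>\<^bsub>G\<^esub> s)} \<rparr>"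

definition prefix_reversal :: "nat \<Rightarrow> nat \<Rightarrow> nat" where
  "prefix_reversal j k = (if 1 \<le> k \<and> k \<le> j then j + 1 - k else k)"

definition prefix_reversals :: "nat \<Rightarrow> (nat \<Rightarrow> nat) set" where
  "prefix_reversals n = {prefix_reversal j | j. 2 \<le> j \<and> j \<le> n}"

text \<open>
  \<open>sym_group n\<close> consists of the functions on \<open>nat\<close> that permute \<open>{1..n}\<close> and fix everything else;
  its product is \<open>(\<circ>)\<close>, so \<open>(g \<otimes> s) k = g (s k)\<close>.
\<close>

definition pancake_graph :: "nat \<Rightarrow> (nat \<Rightarrow> nat) pair_pre_digraph" where
  "pancake_graph n = cayley_graph (sym_group n) (prefix_reversals n)"

definition neighbors :: "('a, 'b) pre_digraph \<Rightarrow> 'a \<Rightarrow> 'a set" where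
  "neighbors G v = {w. v \<rightarrow>\<^bsub>G\<^esub> w}"

text \<open>
  The empty graph is not \<open>connected\<close> in the library's sense; by requiring a proper subset we do not
  count the removal of all vertices as disconnecting the graph.
\<close>

definition vertex_cut :: "('a, 'b) pre_digraph \<Rightarrow> 'a set \<Rightarrow> bool" where
  "vertex_cut G C \<longleftrightarrow> C \<subset> verts G \<and> \<not> Digraph_Component.connected (G \<restriction> (verts G - C))"

text \<open>Cardinality is \<open>card\<close>, so the next two notions are meant for finite graphs only.\<close>

definition minimum_vertex_cut :: "('a, 'b) pre_digraph \<Rightarrow> 'a set \<Rightarrow> bool" where
  "minimum_vertex_cut G C \<longleftrightarrow> vertex_cut G C \<and> (\<forall>D. vertex_cut G D \<longrightarrow> card C \<le> card D)"

definition super_connected :: "('a, 'b) pre_digraph \<Rightarrow> bool" where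
  "super_connected G \<longleftrightarrow>
     (\<forall>C. minimum_vertex_cut G C \<longrightarrow> (\<exists>v\<in>verts G. C = neighbors G v))"

lemma pair_graph_cayley_graph:
  assumes "finite (carrier G)"
  shows "pair_graph (cayley_graph G S)"
proof
  show "finite (pverts (cayley_graph G S))"
    using assms by (simp add: cayley_graph_def)
  show "finite (parcs (cayley_graph G S))"
    by (rule finite_subset[of _ "carrier G \<times> carrier G"]) (auto simp: cayley_graph_def assms)
  show "symmetric (with_proj (cayley_graph G S))"
    by (auto simp: cayley_graph_def symmetric_def arcs_ends_conv intro!: symI)
qed (auto simp: cayley_graph_def)

lemma prefix_reversal_permutes:
  assumes "j \<le> n"
  shows "prefix_reversal j permutes {1..n}"
proof (rule bij_imp_permutes)
  have "prefix_reversal j (prefix_reversal j k) = k" for k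
    by (auto simp: prefix_reversal_def)
  then show "bij_betw (prefix_reversal j) {1..n} {1..n}"
    using assms by (intro bij_betw_byWitness[where f' = "prefix_reversal j"])
      (auto simp: prefix_reversal_def)
qed (use assms in \<open>auto simp: prefix_reversal_def\<close>)

lemma prefix_reversals_subset: "prefix_reversals n \<subseteq> carrier (sym_group n)"
  using prefix_reversal_permutes by (auto simp: prefix_reversals_def sym_group_def)

lemma pair_graph_pancake_graph: "pair_graph (pancake_graph n)"
  unfolding pancake_graph_def
  by (rule pair_graph_cayley_graph) (simp add: sym_group_def finite_permutations)

end

theory Submission
  imports Defs
begin

text \<open>
  Fixing the last entry splits the pancake graph on \<open>n\<close> symbols into \<open>n\<close> copies of the pancake
  graph on \<open>n - 1\<close> symbols; every vertex has exactly one neighbour outside its own copy, via the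
  reversal of full length, and any two copies are joined by many disjoint edges. Let \<open>C\<close> be a cut
  with at most \<open>n - 1\<close> vertices. At most one copy loses \<open>n - 2\<close> or more vertices; by
  induction the other copies stay connected, and \<open>C\<close> is too small to separate them from each
  other. A vertex \<open>x\<close> cut off from this main part lies in the exceptional copy and its outer
  neighbour \<open>y\<close> is in \<open>C\<close>; since \<open>y\<close> is then the only vertex of \<open>C\<close> outside that copy, every
  surviving neighbour of \<open>x\<close> inside the copy would have a surviving outer neighbour. So all
  neighbours of \<open>x\<close> are in \<open>C\<close>.
\<close>

subsection \<open>Cosets of the symmetric groups on initial segments\<close>

lemma prefix_reversal_invol [simp]: "prefix_reversal j (prefix_reversal j k) = k"
  by (auto simp: prefix_reversal_def)

lemma prefix_reversal_comp [simp]: "prefix_reversal j \<circ> prefix_reversal j = id"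
  by (simp add: fun_eq_iff)

lemma prefix_reversal_one: "1 \<le> j \<Longrightarrow> prefix_reversal j 1 = j"
  by (simp add: prefix_reversal_def)

lemma prefix_reversal_last: "1 \<le> j \<Longrightarrow> prefix_reversal j j = 1"
  by (simp add: prefix_reversal_def)

lemma prefix_reversal_above: "j < k \<Longrightarrow> prefix_reversal j k = k"
  by (simp add: prefix_reversal_def)

lemma comp_prefix_reversal_cancel [simp]: "g \<circ> prefix_reversal j \<circ> prefix_reversal j = g"
  by (simp add: comp_assoc)

text \<open>For bijective \<open>g\<close> this is the left coset of \<open>g\<close> by the
  symmetric group on \<open>{1..m}\<close>, taken inside all bijections of \<open>nat\<close>.
  Agreement off \<open>{1..m}\<close> mentions no ambient degree, so the induction on
  \<open>m\<close> treats the whole graph and its copies alike.\<close>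

definition perm_coset :: "nat \<Rightarrow> (nat \<Rightarrow> nat) \<Rightarrow> (nat \<Rightarrow> nat) set" where
  "perm_coset m g = {h. bij h \<and> (\<forall>k. k \<notin> {1..m} \<longrightarrow> h k = g k)}"

lemma perm_coset_self: "bij g \<Longrightarrow> g \<in> perm_coset m g"
  by (simp add: perm_coset_def)

lemma bij_if_perm_coset: "h \<in> perm_coset m g \<Longrightarrow> bij h"
  by (simp add: perm_coset_def)

lemma permutes_if_bij:
  assumes "bij p" "\<And>k. k \<notin> S \<Longrightarrow> p k = k"
  shows "p permutes S"
  using assms by (simp add: permutes_def bij_iff)

lemma perm_coset_id: "perm_coset n id = {p. p permutes {1..n}}"
  unfolding perm_coset_def by (auto intro: permutes_if_bij permutes_bij dest: permutes_not_in)

lemma perm_coset_comp: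
  assumes "h \<in> perm_coset m g" "p permutes {1..m}"
  shows "h \<circ> p \<in> perm_coset m g"
proof -
  have "bij (h \<circ> p)"
    using assms by (auto simp: perm_coset_def intro: bij_comp permutes_bij)
  moreover have "(h \<circ> p) k = g k" if "k \<notin> {1..m}" for k
    using that assms permutes_not_in[OF assms(2) that] by (simp add: perm_coset_def)
  ultimately show ?thesis
    by (simp add: perm_coset_def)
qed

lemma perm_coset_comp_prefix_reversal:
  "h \<in> perm_coset m g \<Longrightarrow> j \<le> m \<Longrightarrow> h \<circ> prefix_reversal j \<in> perm_coset m g"
  by (rule perm_coset_comp[OF _ prefix_reversal_permutes])

text \<open>Both bijections agree on the complement of \<open>{1..m}\<close>, and a bijection maps
  complements to complements.\<close>

lemma perm_coset_image:
  assumes "bij g" "h \<in> perm_coset m g"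
  shows "h ` {1..m} = g ` {1..m}"
proof -
  have "h ` (- {1..m}) = g ` (- {1..m})"
    using assms(2) by (intro image_cong) (auto simp: perm_coset_def)
  then have "- (h ` {1..m}) = - (g ` {1..m})"
    using assms by (simp add: bij_image_Compl_eq bij_if_perm_coset del: atLeastAtMost_iff)
  then show ?thesis by simp
qed

lemma finite_perm_coset:
  assumes "bij g"
  shows "finite (perm_coset m g)"
proof (rule finite_subset)
  show "perm_coset m g \<subseteq> (\<lambda>p. g \<circ> p) ` {p. p permutes {1..m}}"
  proof
    fix h assume h: "h \<in> perm_coset m g"
    have "bij (inv_into UNIV g \<circ> h)"
      using assms h by (simp add: bij_comp bij_imp_bij_inv perm_coset_def)
    moreover have "(inv_into UNIV g \<circ> h) k = k" if "k \<notin> {1..m}" for k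
      using that h assms by (simp add: perm_coset_def bij_is_inj)
    ultimately have "inv_into UNIV g \<circ> h permutes {1..m}"
      by (intro permutes_if_bij) auto
    moreover have "h = g \<circ> (inv_into UNIV g \<circ> h)"
      using assms by (simp add: fun_eq_iff bij_is_surj surj_f_inv_f)
    ultimately show "h \<in> (\<lambda>p. g \<circ> p) ` {p. p permutes {1..m}}"
      by blast
  qed
qed (simp add: finite_permutations)

text \<open>The splitting into copies: an index outside \<open>{1..m}\<close> is either
  \<open>Suc m\<close> or outside \<open>{1..Suc m}\<close>. Hence each class with a fixed last
  entry is again a coset, one degree lower, and the induction hypothesis applies to it.\<close>

lemma perm_coset_fix_last:
  assumes "g \<in> perm_coset (Suc m) g0"
  shows "perm_coset m g = {h \<in> perm_coset (Suc m) g0. h (Suc m) = g (Suc m)}"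
proof -
  have "k \<notin> {1..m} \<longleftrightarrow> k \<notin> {1..Suc m} \<or> k = Suc m" for k
    by auto
  then have "(\<forall>k. k \<notin> {1..m} \<longrightarrow> h k = g k) \<longleftrightarrow>
      (\<forall>k. k \<notin> {1..Suc m} \<longrightarrow> h k = g k) \<and> h (Suc m) = g (Suc m)" for h :: "nat \<Rightarrow> nat"
    by metis
  moreover have "g k = g0 k" if "k \<notin> {1..Suc m}" for k
    using assms that unfolding perm_coset_def by blast
  ultimately show ?thesis
    unfolding perm_coset_def by force
qed

text \<open>Counts the edges between copies \<open>i\<close> and \<open>j\<close>, since the full
  reversal swaps the first and last entries. The exact number is \<open>(m - 1)!\<close>; the linear
  bound is enough here. One swap puts \<open>i\<close> last, a second puts \<open>j\<close> first
  without moving \<open>i\<close>, and exchanging positions 2 and \<open>k\<close> for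
  \<open>k\<close> in \<open>{2..m}\<close> then gives \<open>m - 1\<close> elements.\<close>

lemma card_perm_coset_ends_ge:
  assumes "bij g0" "2 \<le> m" "i \<in> g0 ` {1..Suc m}" "j \<in> g0 ` {1..Suc m}" "i \<noteq> j"
  shows "m - 1 \<le> card {g \<in> perm_coset (Suc m) g0. g (Suc m) = i \<and> g 1 = j}" (is "_ \<le> card ?E")
proof -
  obtain a where a: "a \<in> {1..Suc m}" "g0 a = i"
    using assms(3) by auto
  define g1 where "g1 = g0 \<circ> transpose (Suc m) a"
  have g1: "g1 \<in> perm_coset (Suc m) g0"
    unfolding g1_def
    by (intro perm_coset_comp perm_coset_self assms permutes_swap_id) (use a in auto)
  have g1_last: "g1 (Suc m) = i"
    by (simp add: g1_def a)
  obtain b where b: "b \<in> {1..Suc m}" "g1 b = j"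
    using assms(4) perm_coset_image[OF assms(1) g1] by (metis imageE)
  define g2 where "g2 = g1 \<circ> transpose 1 b"
  have g2: "g2 \<in> perm_coset (Suc m) g0"
    unfolding g2_def
    by (intro perm_coset_comp g1 permutes_swap_id) (use b in auto)
  have "b \<noteq> Suc m"
    using b g1_last assms(5) by auto
  then have g2_ends: "g2 (Suc m) = i" "g2 1 = j"
    using assms(2) b g1_last by (auto simp: g2_def transpose_def)
  have "inj g2"
    using g2 by (simp add: bij_if_perm_coset bij_is_inj)
  \<comment> \<open>The element built from \<open>k\<close> has \<open>g2 k\<close> at position 2,
    which determines \<open>k\<close>.\<close>
  have "inj_on (\<lambda>k. g2 \<circ> transpose 2 k) {2..m}"
  proof (rule inj_onI)
    fix k l assume "g2 \<circ> transpose 2 k = g2 \<circ> transpose 2 l"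
    then have "g2 k = g2 l"
      by (metis comp_apply transpose_apply_first)
    with \<open>inj g2\<close> show "k = l"
      by (simp add: inj_eq)
  qed
  moreover have "(\<lambda>k. g2 \<circ> transpose 2 k) ` {2..m} \<subseteq> ?E"
  proof clarify
    fix k assume k: "k \<in> {2..m}"
    have "g2 \<circ> transpose 2 k \<in> perm_coset (Suc m) g0"
      by (intro perm_coset_comp g2 permutes_swap_id) (use k in auto)
    then show "g2 \<circ> transpose 2 k \<in> perm_coset (Suc m) g0 \<and>
        (g2 \<circ> transpose 2 k) (Suc m) = i \<and> (g2 \<circ> transpose 2 k) 1 = j"
      using k g2_ends by (auto simp: transpose_def)
  qed
  moreover have "finite ?E"
    using finite_perm_coset[OF assms(1)] by simp
  ultimately have "card {2..m} \<le> card ?E"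
    by (rule card_inj_on_le)
  then show ?thesis
    by simp
qed

subsection \<open>Paths avoiding a set of vertices\<close>

text \<open>Adjacency after removal of \<open>C\<close>. No vertex set is recorded: flips of length
  at most \<open>m\<close> never leave a coset for \<open>m\<close>, so one relation describes all
  copies at once.\<close>

definition flip_rel :: "nat \<Rightarrow> (nat \<Rightarrow> nat) set \<Rightarrow> ((nat \<Rightarrow> nat) \<times> (nat \<Rightarrow> nat)) set" where
  "flip_rel m C = {(g, h). g \<notin> C \<and> h \<notin> C \<and> (\<exists>j\<in>{2..m}. h = g \<circ> prefix_reversal j)}"

lemma flip_relI:
  "g \<notin> C \<Longrightarrow> g \<circ> prefix_reversal j \<notin> C \<Longrightarrow> 2 \<le> j \<Longrightarrow> j \<le> m \<Longrightarrow>
    (g, g \<circ> prefix_reversal j) \<in> flip_rel m C"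
  by (auto simp: flip_rel_def)

lemma sym_rtrancl_flip_rel: "sym ((flip_rel m C)\<^sup>*)"
proof (intro sym_rtrancl symI)
  fix g h assume "(g, h) \<in> flip_rel m C"
  then obtain j where "j \<in> {2..m}" "h = g \<circ> prefix_reversal j" "g \<notin> C" "h \<notin> C"
    by (auto simp: flip_rel_def)
  then show "(h, g) \<in> flip_rel m C"
    using flip_relI[of h C j m] by simp
qed

lemma flip_rel_mono: "m \<le> n \<Longrightarrow> flip_rel m C \<subseteq> flip_rel n C"
  by (auto simp: flip_rel_def)

text \<open>The inductive step, used both for the connectivity bound and for the final theorem.
  Assumption \<open>conn\<close> is the connectivity of the copies, whose vertices have
  \<open>m - 1\<close> neighbours within their copy. Assumption \<open>two\<close> excludes a real
  exception: for \<open>m = 2\<close> the coset is a 6-cycle, and removing two opposite vertices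
  leaves two paths without an isolated vertex.\<close>

lemma separated_imp_neighbors_removed:
  assumes m: "2 \<le> m"
    and conn: "\<And>g h. bij g \<Longrightarrow> h \<in> perm_coset m g \<Longrightarrow> g \<notin> C \<Longrightarrow> h \<notin> C \<Longrightarrow>
      card (C \<inter> perm_coset m g) < m - 1 \<Longrightarrow> (g, h) \<in> (flip_rel m C)\<^sup>*"
    and g0: "bij g0"
    and card_le: "card (C \<inter> perm_coset (Suc m) g0) \<le> m"
    and two: "m = 2 \<Longrightarrow> card (C \<inter> perm_coset (Suc m) g0) \<le> 1"
    and sep: "u \<in> perm_coset (Suc m) g0" "v \<in> perm_coset (Suc m) g0" "u \<notin> C" "v \<notin> C"
      "(u, v) \<notin> (flip_rel (Suc m) C)\<^sup>*"
  shows "\<exists>x\<in>perm_coset (Suc m) g0. x \<notin> C \<and> (\<forall>j\<in>{2..Suc m}. x \<circ> prefix_reversal j \<in> C)"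
proof (rule ccontr)
  define n where "n = Suc m"
  define K where "K = perm_coset n g0"
  define D where "D = C \<inter> K"
  define V where "V i = {g \<in> K. g n = i}" for i
  define E where "E i j = {g \<in> K. g n = i \<and> g 1 = j}" for i j
  \<comment> \<open>A good copy has lost fewer vertices than its degree, so \<open>conn\<close>
    keeps what is left of it connected.\<close>
  define good where "good i \<longleftrightarrow> card (D \<inter> V i) < m - 1" for i
  define R where "R = (flip_rel n C)\<^sup>*"
  let ?I = "g0 ` {1..n}"
  let ?r = "prefix_reversal n"
  assume "\<not> ?thesis"
  then have escape: "\<exists>j\<in>{2..n}. x \<circ> prefix_reversal j \<notin> C" if "x \<in> K" "x \<notin> C" for x
    using that by (auto simp: K_def n_def)
  have n: "3 \<le> n"
    using m by (simp add: n_def)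
  have fin_K: "finite K"
    using g0 by (simp add: K_def finite_perm_coset)
  then have fin_D: "finite D"
    by (simp add: D_def)
  have card_D: "card D \<le> m"
    using card_le by (simp add: D_def K_def n_def)
  have R_sym: "(h, g) \<in> R" if "(g, h) \<in> R" for g h
    using that symD[OF sym_rtrancl_flip_rel] by (auto simp: R_def)
  have R_trans: "(g, k) \<in> R" if "(g, h) \<in> R" "(h, k) \<in> R" for g h k
    using that by (simp add: R_def)
  have R_flip: "(g, g \<circ> prefix_reversal j) \<in> R"
    if "g \<notin> C" "g \<circ> prefix_reversal j \<notin> C" "j \<in> {2..n}" for g j
    using that flip_relI[of g C j n] by (auto simp: R_def)
  have K_flip: "g \<circ> prefix_reversal j \<in> K" if "g \<in> K" "j \<le> n" for g j
    using that perm_coset_comp_prefix_reversal by (simp add: K_def)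
  have flip_ends: "(g \<circ> ?r) n = g 1" "(g \<circ> ?r) 1 = g n" for g :: "nat \<Rightarrow> nat"
    using n prefix_reversal_one[of n] prefix_reversal_last[of n] by auto
  have K_inj: "g k = g l \<longleftrightarrow> k = l" if "g \<in> K" for g k l
    using that by (metis K_def bij_if_perm_coset bij_is_inj inj_eq)
  have flip_leaves: "(g \<circ> ?r) n \<noteq> g n" if "g \<in> K" for g
    using that n K_inj[of g 1 n] flip_ends(1)[of g] by (simp del: comp_apply)
  have K_range: "g k \<in> ?I" if "g \<in> K" "k \<in> {1..n}" for g k
    using that perm_coset_image[OF g0, of g n] by (metis K_def imageI)
  have same: "(g, h) \<in> R"
    if "g \<in> K" "h \<in> K" "g \<notin> C" "h \<notin> C" "g n = h n" "good (g n)" for g h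
  proof -
    have V_eq: "perm_coset m g = V (g n)"
      using that perm_coset_fix_last by (simp add: K_def V_def n_def)
    have "D \<inter> V (g n) = C \<inter> perm_coset m g"
      by (auto simp: V_eq D_def V_def)
    then have "(g, h) \<in> (flip_rel m C)\<^sup>*"
      using that V_eq by (intro conn) (auto simp: V_def K_def good_def bij_if_perm_coset)
    then show ?thesis
      using rtrancl_mono[OF flip_rel_mono[of m n C]] by (auto simp: R_def n_def)
  qed
  have card_D_split: "card (D \<inter> A) + card (D \<inter> B) \<le> card D" if "A \<inter> B = {}" for A B
  proof -
    have "card (D \<inter> A) + card (D \<inter> B) = card (D \<inter> A \<union> D \<inter> B)"
      using that fin_D by (subst card_Un_disjoint) auto
    also have "\<dots> \<le> card D"
      using fin_D by (intro card_mono) auto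
    finally show ?thesis .
  qed
  \<comment> \<open>Two bad copies would use \<open>2 * (m - 1)\<close> vertices of
    \<open>D\<close>. This exceeds \<open>m\<close> for \<open>m \<ge> 3\<close>, and exceeds the
    bound 1 given by \<open>two\<close> for \<open>m = 2\<close>.\<close>
  have one_bad: "good i \<or> good j" if "i \<noteq> j" for i j
  proof (rule ccontr)
    assume bad: "\<not> ?thesis"
    have "V i \<inter> V j = {}"
      using that by (auto simp: V_def)
    from card_D_split[OF this] bad have "2 * (m - 1) \<le> card D"
      by (simp add: good_def)
    then show False
      using m card_D two by (cases "m = 2") (auto simp: D_def K_def n_def)
  qed
  \<comment> \<open>The full reversal matches \<open>E i j\<close> with \<open>E j i\<close>. The
    matching edges are disjoint, so blocking all of them takes at least one vertex of
    \<open>D\<close> per edge.\<close>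
  have killed: "m - 1 \<le> card (D \<inter> (E i j \<union> E j i))"
    if "i \<in> ?I" "j \<in> ?I" "i \<noteq> j" "\<And>g. g \<in> E i j \<Longrightarrow> g \<in> C \<or> g \<circ> ?r \<in> C" for i j
  proof -
    have "E i j \<subseteq> D \<inter> E i j \<union> (\<lambda>g. g \<circ> ?r) ` (D \<inter> E j i)"
    proof
      fix g assume g: "g \<in> E i j"
      show "g \<in> D \<inter> E i j \<union> (\<lambda>g. g \<circ> ?r) ` (D \<inter> E j i)"
      proof (cases "g \<in> C")
        case True
        with g show ?thesis by (auto simp: D_def E_def)
      next
        case False
        with g that(4) have "g \<circ> ?r \<in> C" by blast
        then have "g \<circ> ?r \<in> D \<inter> E j i"
          using g K_flip[of g n] flip_ends[of g] by (auto simp: D_def E_def)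
        moreover have "g = (g \<circ> ?r) \<circ> ?r" by simp
        ultimately show ?thesis by blast
      qed
    qed
    then have "card (E i j) \<le> card (D \<inter> E i j \<union> (\<lambda>g. g \<circ> ?r) ` (D \<inter> E j i))"
      using fin_D by (intro card_mono) auto
    also have "\<dots> \<le> card (D \<inter> E i j) + card (D \<inter> E j i)"
      by (rule order_trans[OF card_Un_le]) (use fin_D in \<open>auto intro: card_image_le\<close>)
    also have "\<dots> = card (D \<inter> E i j \<union> D \<inter> E j i)"
      using that fin_D by (subst card_Un_disjoint) (auto simp: E_def)
    also have "D \<inter> E i j \<union> D \<inter> E j i = D \<inter> (E i j \<union> E j i)"
      by blast
    finally show ?thesis
      using card_perm_coset_ends_ge[OF g0 m, of i j] that by (auto simp: E_def K_def n_def)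
  qed
  have link: "(g, h) \<in> R"
    if "g \<in> K" "h \<in> K" "g \<notin> C" "h \<notin> C" "good (g n)" "good (h n)"
      "k \<in> E (g n) (h n)" "k \<notin> C" "k \<circ> ?r \<notin> C" for g h k
  proof -
    have k: "k \<in> K" "k n = g n" "k 1 = h n"
      using that by (auto simp: E_def)
    have "(g, k) \<in> R" "(k, k \<circ> ?r) \<in> R"
      using that k n same[of g k] by (auto intro: R_flip)
    moreover have "(k \<circ> ?r, h) \<in> R"
      using that k K_flip[of k n] flip_ends[of k] by (intro same) auto
    ultimately show ?thesis
      by (blast intro: R_trans)
  qed
  have good_conn: "(g, h) \<in> R"
    if "g \<in> K" "h \<in> K" "g \<notin> C" "h \<notin> C" "good (g n)" "good (h n)" for g h
  proof (cases "g n = h n")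
    case True
    with that show ?thesis by (simp add: same)
  next
    case ne: False
    let ?i = "g n" and ?j = "h n"
    have I: "?i \<in> ?I" "?j \<in> ?I"
      using that K_range n by auto
    show ?thesis
    proof (cases "\<exists>k\<in>E ?i ?j. k \<notin> C \<and> k \<circ> ?r \<notin> C")
      case True
      with that link show ?thesis by blast
    next
      case False
      then have kill: "m - 1 \<le> card (D \<inter> (E ?i ?j \<union> E ?j ?i))"
        using killed[OF I ne] by blast
      \<comment> \<open>For \<open>m = 2\<close> a good copy has lost no vertex at all, so no edge
        between two good copies is blocked.\<close>
      have "m \<noteq> 2"
      proof
        assume "m = 2"
        then have "D \<inter> V ?i = {}" "D \<inter> V ?j = {}"
          using that fin_D by (auto simp: good_def)
        then have "D \<inter> (E ?i ?j \<union> E ?j ?i) = {}"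
          by (auto simp: E_def V_def)
        with kill show False
          using \<open>m = 2\<close> by simp
      qed
      \<comment> \<open>With at least four copies, blocking the two copies from each other uses up so many vertices
        of \<open>C\<close> that the rest cannot block a detour through a third copy.\<close>
      have not_killed: "\<exists>w\<in>E i k. w \<notin> C \<and> w \<circ> ?r \<notin> C"
        if "i \<in> ?I" "k \<in> ?I" "i \<noteq> k" "k \<noteq> ?i" "k \<noteq> ?j" for i k
      proof (rule ccontr)
        assume "\<not> ?thesis"
        then have "m - 1 \<le> card (D \<inter> (E i k \<union> E k i))"
          using killed[OF that(1-3)] by blast
        moreover have disj: "(E ?i ?j \<union> E ?j ?i) \<inter> (E i k \<union> E k i) = {}"
          using that by (auto simp: E_def)
        ultimately have "2 * (m - 1) \<le> card D"
          using kill card_D_split[OF disj] by simp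
        then show False
          using card_D m \<open>m \<noteq> 2\<close> by simp
      qed
      \<comment> \<open>Now \<open>n \<ge> 4\<close>, so at least two further copies exist; at most
        one copy is bad, so one of these two is good.\<close>
      have "card ?I = n"
        using g0 by (subst card_image) (auto intro: inj_on_subset[OF bij_is_inj])
      moreover have "card {?i, ?j} = 2"
        using ne by simp
      ultimately have "2 \<le> card (?I - {?i, ?j})"
        using I m \<open>m \<noteq> 2\<close> by (subst card_Diff_subset) (auto simp: n_def)
      then obtain T where T: "T \<subseteq> ?I - {?i, ?j}" "card T = 2"
        by (rule obtain_subset_with_card_n)
      from T(2) obtain k l where kl: "T = {k, l}" "k \<noteq> l"
        unfolding card_2_iff by blast
      with T(1) one_bad[OF kl(2)] obtain k where k: "k \<in> ?I" "k \<noteq> ?i" "k \<noteq> ?j" "good k"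
        by blast
      obtain w where w: "w \<in> E ?i k" "w \<notin> C" "w \<circ> ?r \<notin> C"
        using not_killed[of ?i k] k I by blast
      obtain w' where w': "w' \<in> E ?j k" "w' \<notin> C" "w' \<circ> ?r \<notin> C"
        using not_killed[of ?j k] k I by blast
      have z: "w \<circ> ?r \<in> K" "(w \<circ> ?r) n = k"
        using w K_flip[of w n] flip_ends[of w] by (auto simp: E_def)
      have "(g, w \<circ> ?r) \<in> R"
        using that z w k link[of g "w \<circ> ?r" w] by simp
      moreover have "(h, w \<circ> ?r) \<in> R"
        using that z w w' k link[of h "w \<circ> ?r" w'] by simp
      ultimately show ?thesis
        by (blast intro: R_trans R_sym)
    qed
  qed
  have to_good: "\<exists>y\<in>K. y \<notin> C \<and> good (y n) \<and> (x, y) \<in> R" if x: "x \<in> K" "x \<notin> C" for x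
  proof (cases "good (x n)")
    case True
    with x show ?thesis by (auto simp: R_def)
  next
    case bad: False
    have good_off: "good i" if "i \<noteq> x n" for i
      using one_bad[OF that] bad by blast
    define y where "y = x \<circ> ?r"
    have y: "y \<in> K" "y n \<noteq> x n"
      using x K_flip flip_leaves by (auto simp: y_def)
    show ?thesis
    proof (cases "y \<in> C")
      case False
      then have "(x, y) \<in> R"
        using R_flip[of x n] x n by (simp add: y_def)
      with y False good_off show ?thesis by blast
    next
      case True
      \<comment> \<open>The bad copy of \<open>x\<close> holds at least \<open>m - 1\<close> of the
        at most \<open>m\<close> vertices of \<open>D\<close>, so \<open>y\<close> is the only one
        outside it.\<close>
      have "card (D \<inter> V (x n)) + card (D \<inter> - V (x n)) \<le> card D"
        by (rule card_D_split) simp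
      then have "card (D \<inter> - V (x n)) \<le> 1"
        using bad card_D by (simp add: good_def)
      moreover have "y \<in> D \<inter> - V (x n)"
        using y True by (simp add: D_def V_def)
      ultimately have only_y: "z = y" if "z \<in> D \<inter> - V (x n)" for z
        using that fin_D card_le_Suc0_iff_eq[of "D \<inter> - V (x n)"] by auto
      obtain j where j: "j \<in> {2..n}" "x \<circ> prefix_reversal j \<notin> C"
        using escape[OF x] by blast
      define z where "z = x \<circ> prefix_reversal j"
      \<comment> \<open>The flip of length \<open>n\<close> leads to the removed vertex
        \<open>y\<close>, so the surviving neighbour \<open>z\<close> is in the same copy as
        \<open>x\<close>.\<close>
      have "j < n"
        using j True by (cases "j = n") (auto simp: y_def)
      then have z: "z \<in> K" "z n = x n" "z \<notin> C"
        using j K_flip x by (auto simp: z_def prefix_reversal_above)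
      \<comment> \<open>Here \<open>z 1 = x j\<close> with \<open>j \<ge> 2\<close>. The full
        reversal moves first entries to the end, so the outer neighbours of \<open>x\<close> and
        \<open>z\<close> have different last entries.\<close>
      have "z 1 \<noteq> x 1"
        using j x K_inj prefix_reversal_one[of j] by (simp add: z_def)
      then have "z \<circ> ?r \<noteq> y"
        using flip_ends unfolding y_def by metis
      moreover have z': "z \<circ> ?r \<in> K" "(z \<circ> ?r) n \<noteq> x n"
        using z K_flip[of z n] flip_leaves[of z] by auto
      ultimately have "z \<circ> ?r \<notin> C"
        using only_y[of "z \<circ> ?r"] by (auto simp: D_def V_def)
      moreover from this have "(x, z \<circ> ?r) \<in> R"
        using R_flip[of x j] R_flip[of z n] x z j n R_trans unfolding z_def by auto
      ultimately show ?thesis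
        using z' good_off by blast
    qed
  qed
  have uv: "u \<in> K" "v \<in> K"
    using sep by (auto simp: K_def n_def)
  obtain a b where "a \<in> K" "a \<notin> C" "good (a n)" "(u, a) \<in> R" "b \<in> K" "b \<notin> C" "good (b n)" "(v, b) \<in> R"
    using to_good[OF uv(1) sep(3)] to_good[OF uv(2) sep(4)] by blast
  then have "(u, v) \<in> R"
    using good_conn[of a b] by (blast intro: R_trans R_sym)
  then show False
    using sep by (simp add: R_def n_def)
qed

text \<open>The first entry of \<open>g \<circ> prefix_reversal j\<close> is \<open>g j\<close>,
  from which \<open>j\<close> is recovered.\<close>

lemma inj_on_flips: "inj g \<Longrightarrow> inj_on (\<lambda>j. g \<circ> prefix_reversal j) {2..m}"
proof (rule inj_onI)
  fix j k assume "inj g" "j \<in> {2..m}" "k \<in> {2..m}"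
    and "g \<circ> prefix_reversal j = g \<circ> prefix_reversal k"
  then have "g (prefix_reversal j 1) = g (prefix_reversal k 1)"
    by (metis comp_apply)
  with \<open>inj g\<close> \<open>j \<in> {2..m}\<close> \<open>k \<in> {2..m}\<close> show "j = k"
    by (simp add: inj_eq prefix_reversal_one del: One_nat_def)
qed

text \<open>The pancake graph on \<open>m\<close> symbols is \<open>(m - 1)\<close>-connected. For
  \<open>m = 2\<close> the coset consists of \<open>g\<close> and its single flip. In the step, a
  separation would yield a vertex whose \<open>m\<close> distinct neighbours are all removed, while
  fewer than \<open>m\<close> vertices of the coset are.\<close>

lemma connected_avoiding_few:
  assumes "2 \<le> m" "bij g" "h \<in> perm_coset m g" "g \<notin> C" "h \<notin> C"
    and "card (C \<inter> perm_coset m g) < m - 1"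
  shows "(g, h) \<in> (flip_rel m C)\<^sup>*"
  using assms
proof (induction m arbitrary: g h rule: nat_induct_at_least)
  case base
  have h: "bij h" "\<And>k. k \<notin> {1, 2} \<Longrightarrow> h k = g k" "h ` {1, 2} = g ` {1, 2}"
    using base perm_coset_image[of g h 2]
    by (auto simp: perm_coset_def atLeastAtMost_insertL[symmetric] numeral_2_eq_2)
  have "h 1 \<noteq> h 2"
    using h(1) by (metis bij_is_inj inj_eq one_eq_numeral_iff semiring_norm(85))
  then have "h 1 = g 1 \<and> h 2 = g 2 \<or> h 1 = g 2 \<and> h 2 = g 1"
    using h(3) by (auto simp: doubleton_eq_iff)
  then have "h = g \<or> h = g \<circ> prefix_reversal 2"
  proof
    assume "h 1 = g 1 \<and> h 2 = g 2"
    with h(2) show ?thesis by (metis insertE singletonD ext)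
  next
    assume *: "h 1 = g 2 \<and> h 2 = g 1"
    have "h k = (g \<circ> prefix_reversal 2) k" for k
    proof (cases "k \<in> {1, 2}")
      case True
      with * show ?thesis by (auto simp: prefix_reversal_def)
    next
      case False
      then have "prefix_reversal 2 k = k"
        by (auto simp: prefix_reversal_def)
      with h(2)[OF False] show ?thesis by simp
    qed
    then show ?thesis by blast
  qed
  then show ?case
    using base flip_relI[of g C 2 2] by auto
next
  case (Suc m)
  let ?K = "perm_coset (Suc m) g"
  show ?case
  proof (rule ccontr)
    assume not_conn: "\<not> ?case"
    \<comment> \<open>The strict bound also covers the special case of degree 2: fewer than 2
      removed vertices means at most 1.\<close>
    have "\<exists>x\<in>?K. x \<notin> C \<and> (\<forall>j\<in>{2..Suc m}. x \<circ> prefix_reversal j \<in> C)"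
      by (rule separated_imp_neighbors_removed[OF \<open>2 \<le> m\<close> Suc.IH, of g g h])
        (use Suc.prems not_conn in \<open>auto simp: perm_coset_self\<close>)
    then obtain x where x: "x \<in> ?K" "\<forall>j\<in>{2..Suc m}. x \<circ> prefix_reversal j \<in> C"
      by blast
    have "inj x"
      using x by (simp add: bij_if_perm_coset bij_is_inj)
    then have "card {2..Suc m} \<le> card (C \<inter> ?K)"
      using x Suc.prems finite_perm_coset perm_coset_comp_prefix_reversal[OF x(1)]
      by (intro card_inj_on_le[OF inj_on_flips]) auto
    with Suc.prems show False by simp
  qed
qed

subsection \<open>Vertex cuts of the pancake graph\<close>

lemma pverts_pancake_graph: "pverts (pancake_graph n) = perm_coset n id"
  by (simp add: pancake_graph_def cayley_graph_def sym_group_def perm_coset_id)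

text \<open>Prefix reversals are involutions, so the two directions in \<open>cayley_graph\<close>
  coincide. There are no loops to exclude, because a flip with \<open>j \<ge> 2\<close> changes the
  first entry.\<close>

lemma parcs_pancake_graph:
  "parcs (pancake_graph n) =
    {(g, h). g \<in> perm_coset n id \<and> h \<in> perm_coset n id \<and> (\<exists>j\<in>{2..n}. h = g \<circ> prefix_reversal j)}"
proof -
  let ?K = "perm_coset n id"
  have "g \<noteq> g \<circ> prefix_reversal j" if "bij g" "j \<in> {2..n}" for g :: "nat \<Rightarrow> nat" and j
  proof
    assume "g = g \<circ> prefix_reversal j"
    then have "g 1 = g (prefix_reversal j 1)"
      by (metis comp_apply)
    with that show False
      by (simp add: bij_is_inj inj_eq prefix_reversal_one del: One_nat_def)
  qed
  then have "g \<in> ?K \<and> h \<in> ?K \<and> g \<noteq> h \<and>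
      (\<exists>j\<in>{2..n}. h = g \<circ> prefix_reversal j \<or> g = h \<circ> prefix_reversal j) \<longleftrightarrow>
    g \<in> ?K \<and> h \<in> ?K \<and> (\<exists>j\<in>{2..n}. h = g \<circ> prefix_reversal j)" for g h
    using bij_if_perm_coset[of g n id] by (metis comp_prefix_reversal_cancel)
  moreover have "parcs (pancake_graph n) = {(g, h). g \<in> ?K \<and> h \<in> ?K \<and> g \<noteq> h \<and>
      (\<exists>j\<in>{2..n}. h = g \<circ> prefix_reversal j \<or> g = h \<circ> prefix_reversal j)}"
  proof -
    have "carrier (sym_group n) = ?K"
      by (simp add: sym_group_def perm_coset_id)
    moreover have "(\<otimes>\<^bsub>sym_group n\<^esub>) = (\<circ>)"
      by (simp add: sym_group_def)
    moreover have "prefix_reversals n = prefix_reversal ` {2..n}"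
      by (auto simp: prefix_reversals_def)
    ultimately show ?thesis
      by (simp add: pancake_graph_def cayley_graph_def)
  qed
  ultimately show ?thesis
    by simp
qed

lemma neighbors_pancake_graph:
  assumes "v \<in> perm_coset n id"
  shows "neighbors (with_proj (pancake_graph n)) v = (\<lambda>j. v \<circ> prefix_reversal j) ` {2..n}"
proof -
  have "neighbors (with_proj (pancake_graph n)) v = {w. (v, w) \<in> parcs (pancake_graph n)}"
    by (simp add: neighbors_def)
  also have "\<dots> = (\<lambda>j. v \<circ> prefix_reversal j) ` {2..n}"
    unfolding parcs_pancake_graph using assms perm_coset_comp_prefix_reversal[of v n id] by fastforce
  finally show ?thesis .
qed

lemma card_neighbors_pancake_graph:
  assumes "v \<in> perm_coset n id"
  shows "card (neighbors (with_proj (pancake_graph n)) v) = n - 1"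
proof -
  have "inj v"
    using assms by (simp add: bij_if_perm_coset bij_is_inj)
  then show ?thesis
    using assms by (simp add: neighbors_pancake_graph card_image[OF inj_on_flips])
qed

text \<open>Translates the library notion of connectedness, which goes through the symmetric closure
  and includes nonemptiness, into \<open>flip_rel\<close>.\<close>

lemma connected_pancake_graph_minus_iff:
  "Digraph_Component.connected (with_proj (pancake_graph n) \<restriction> (perm_coset n id - C)) \<longleftrightarrow>
    perm_coset n id - C \<noteq> {} \<and>
    (\<forall>g\<in>perm_coset n id - C. \<forall>h\<in>perm_coset n id - C. (g, h) \<in> (flip_rel n C)\<^sup>*)"
proof -
  let ?K = "perm_coset n id"
  let ?H = "with_proj (pancake_graph n) \<restriction> (?K - C)"
  have flip_closed: "h \<in> ?K" if "g \<in> ?K" "(g, h) \<in> flip_rel n C" for g h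
    using that perm_coset_comp_prefix_reversal[of g n id] by (auto simp: flip_rel_def)
  \<comment> \<open>The arcs are already symmetric, so the symmetric closure adds nothing.\<close>
  have parcs: "parcs (mk_symmetric ?H) = {(g, h). g \<in> ?K \<and> (g, h) \<in> flip_rel n C}" (is "?L = ?A")
  proof -
    have dir: "(g, h) \<in> arcs ?H \<longleftrightarrow> (g, h) \<in> ?A" for g h
      using flip_closed[of g h] by (auto simp: parcs_pancake_graph flip_rel_def)
    have sym: "(h, g) \<in> ?A" if "(g, h) \<in> ?A" for g h
      using that flip_closed[of g h] by (force simp: flip_rel_def)
    have ends: "tail ?H = fst" "head ?H = snd"
      by simp_all
    have L: "(g, h) \<in> ?L \<longleftrightarrow> (g, h) \<in> arcs ?H \<or> (h, g) \<in> arcs ?H" for g h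
      unfolding parcs_mk_symmetric ends by force
    show ?thesis
    proof (rule Set.set_eqI)
      fix e
      show "e \<in> ?L \<longleftrightarrow> e \<in> ?A"
      proof (cases e)
        case (Pair g h)
        show ?thesis
          unfolding Pair L dir using sym[of h g] by blast
      qed
    qed
  qed
  have reach: "g \<rightarrow>\<^sup>*\<^bsub>mk_symmetric ?H\<^esub> h \<longleftrightarrow> (g, h) \<in> rtrancl_on (?K - C) ?A" for g h
    unfolding reachable_def by (simp add: parcs)
  have "(g, h) \<in> rtrancl_on (?K - C) ?A \<longleftrightarrow> (g, h) \<in> (flip_rel n C)\<^sup>*" if g: "g \<in> ?K - C" for g h
  proof
    assume "(g, h) \<in> rtrancl_on (?K - C) ?A"
    then have "(g, h) \<in> ?A\<^sup>*"
      by (rule rtrancl_on_rtranclI)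
    then show "(g, h) \<in> (flip_rel n C)\<^sup>*"
      by (rule rtrancl_mono[THEN subsetD, rotated]) blast
  next
    assume "(g, h) \<in> (flip_rel n C)\<^sup>*"
    \<comment> \<open>Membership is carried along the path because \<open>rtrancl_on\<close> demands
      it of every vertex visited.\<close>
    then have "h \<in> ?K - C \<and> (g, h) \<in> rtrancl_on (?K - C) ?A"
    proof (induction rule: rtrancl_induct)
      case base
      with g show ?case by blast
    next
      case (step y z)
      moreover from step(2) have "z \<notin> C"
        by (auto simp: flip_rel_def)
      ultimately have "z \<in> ?K - C"
        using flip_closed by blast
      with step show ?case
        by (blast intro: rtrancl_on_into_rtrancl_on)
    qed
    then show "(g, h) \<in> rtrancl_on (?K - C) ?A" ..
  qed
  then show ?thesis
    unfolding Digraph_Component.connected_def strongly_connected_def reach by simp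
qed

text \<open>Bounds the size of a minimum cut by \<open>n - 1\<close>. Removing the neighbours
  isolates \<open>id\<close>. The transposition of 2 and 3 survives as a second vertex, since it
  fixes 1 while every neighbour of \<open>id\<close> moves 1.\<close>

lemma vertex_cut_neighbors_id:
  assumes "3 \<le> n"
  shows "vertex_cut (with_proj (pancake_graph n)) (neighbors (with_proj (pancake_graph n)) id)"
proof -
  let ?K = "perm_coset n id"
  let ?N = "neighbors (with_proj (pancake_graph n)) id"
  define t where "t = transpose (2::nat) 3"
  have id: "id \<in> ?K"
    by (simp add: perm_coset_self)
  have N: "?N = prefix_reversal ` {2..n}"
    using neighbors_pancake_graph[OF id] by simp
  have "id \<circ> t \<in> ?K"
    unfolding t_def by (intro perm_coset_comp id permutes_swap_id) (use assms in auto)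
  then have t: "t \<in> ?K"
    by simp
  have N_one: "p 1 \<noteq> 1" if "p \<in> ?N" for p
    using that by (auto simp: N prefix_reversal_one simp del: One_nat_def)
  have id_N: "id \<notin> ?N" and t_N: "t \<notin> ?N"
    using N_one[of id] N_one[of t] by (auto simp: t_def transpose_def)
  have "t \<noteq> id"
    by (metis id_apply numeral_eq_iff semiring_norm(89) t_def transpose_apply_first)
  have "(id, t) \<notin> (flip_rel n ?N)\<^sup>*"
  proof
    assume "(id, t) \<in> (flip_rel n ?N)\<^sup>*"
    then obtain h where "(id, h) \<in> flip_rel n ?N"
      using \<open>t \<noteq> id\<close> by (metis converse_rtranclE)
    then show False
      by (auto simp: flip_rel_def N)
  qed
  then have "\<not> Digraph_Component.connected (with_proj (pancake_graph n) \<restriction> (?K - ?N))"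
    using id t id_N t_N by (auto simp: connected_pancake_graph_minus_iff)
  moreover have "?N \<subset> ?K"
    using id id_N perm_coset_comp_prefix_reversal[OF id] by (auto simp: N)
  ultimately show ?thesis
    by (simp add: vertex_cut_def pverts_pancake_graph)
qed

theorem theorem2p4:
  fixes n :: nat
  assumes "n \<ge> 4"
  shows "super_connected (with_proj (pancake_graph n))"
  unfolding super_connected_def
proof (intro allI impI)
  fix C
  let ?G = "with_proj (pancake_graph n)"
  let ?K = "perm_coset n id"
  assume C: "minimum_vertex_cut ?G C"
  then have "card C \<le> card (neighbors ?G id)"
    using vertex_cut_neighbors_id[of n] assms by (simp add: minimum_vertex_cut_def)
  then have card_C: "card C \<le> n - 1"
    by (simp add: card_neighbors_pancake_graph perm_coset_self)
  have CK: "C \<subset> ?K" and "\<not> Digraph_Component.connected (?G \<restriction> (?K - C))"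
    using C by (simp_all add: minimum_vertex_cut_def vertex_cut_def pverts_pancake_graph)
  then obtain u v where "u \<in> ?K" "v \<in> ?K" "u \<notin> C" "v \<notin> C" "(u, v) \<notin> (flip_rel n C)\<^sup>*"
    by (auto simp: connected_pancake_graph_minus_iff)
  moreover obtain m where m: "n = Suc m" "3 \<le> m"
    using assms by (cases n) auto
  moreover have "C \<inter> ?K = C"
    using CK by blast
  moreover have "(g, h) \<in> (flip_rel m C)\<^sup>*"
    if "bij g" "h \<in> perm_coset m g" "g \<notin> C" "h \<notin> C" "card (C \<inter> perm_coset m g) < m - 1" for g h
    by (rule connected_avoiding_few) (use that m in auto)
  \<comment> \<open>Since \<open>n \<ge> 4\<close> gives \<open>m \<ge> 3\<close>, the special case
    \<open>m = 2\<close> does not arise and the full bound \<open>card C \<le> m\<close> is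
    admissible.\<close>
  ultimately have "\<exists>x\<in>?K. x \<notin> C \<and> (\<forall>j\<in>{2..n}. x \<circ> prefix_reversal j \<in> C)"
    using separated_imp_neighbors_removed[of m C id u v] card_C by simp
  then obtain x where x: "x \<in> ?K" "neighbors ?G x \<subseteq> C"
    by (auto simp: neighbors_pancake_graph)
  have "finite C"
    using CK finite_perm_coset[of id n] finite_subset by auto
  \<comment> \<open>A subset of \<open>C\<close> with \<open>n - 1\<close> elements must be all of
    \<open>C\<close>, which has at most that many.\<close>
  then have "neighbors ?G x = C"
    using x card_C by (intro card_seteq) (auto simp: card_neighbors_pancake_graph)
  with x show "\<exists>v\<in>verts ?G. C = neighbors ?G v"
    by (auto simp: pverts_pancake_graph)
qed

end
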